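(* Let $h(\mathbf{x})=\bm{\beta}^\top\phi(\mathbf{x})$ be a generalized additive model, where $\phi:\mathcal{X}\to\mathcal{H}$ and $\bm{\beta}=(\bm{\beta}_1,\ldots,\bm{\beta}_C)$ with $\bm{\beta}_c\in\mathcal{H}$. Assume the distribution $\mathcal{D}$ of $(\mathbf{x},y)$ on $\mathcal{X}\times\mathbb{R}^C$ is such that $y=h(\mathbf{x})+\bm{\epsilon}$, where $\bm{\epsilon}\in\mathbb{R}^C$ is independent of $\mathbf{x}$ and has independent coordinates, each satisfying $\mathbb{E}[\epsilon_c]=0$ and $\mathbb{E}[\epsilon_c^2]\le\sigma^2$ for all $c\in\{1,\ldots,C\}$. Assume further that $\phi$ is $L$-Lipschitz, that is, $\|\phi(\mathbf{x})-\phi(\tilde{\mathbf{x}})\|_{\mathcal{H}}\le L\|\mathbf{x}-\tilde{\mathbf{x}}\|_2$ for all $\mathbf{x},\tilde{\mathbf{x}}\in\mathcal{X}$. Let $\Sigma=\mathbb{E}_{\mathbf{x}}[\phi(\mathbf{x})\phi(\mathbf{x})^\top]$. Then for every bounded linear map $\bm{M}:\mathcal{H}\to\mathcal{H}$, the feature $f=\bm{M}^\top\phi$ satisfies, for every $c\in\{1,\ldots,C\}$, $$s_{\mathcal{D},\bm{\beta},c}(f)\;\ge\;\bm{\beta}_c^\top\Sigma\bm{M}\bm{\beta}_c-L\,\Delta\,\|\bm{M}\|_{op}\,\|\bm{\beta}_c\|_{\mathcal{H}}\sqrt{\sigma^2+\bm{\beta}_c^\top\Sigma\bm{\beta}_c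}.$$
   Context: $\mathcal{X}\subseteq\mathbb{R}^d$, $C\ge1$ is an integer, $\Delta\ge0$ is a fixed perturbation budget, and $\mathcal{H}$ is a real Hilbert space (e.g. $\mathbb{R}^p$), with $u^\top v$ denoting the inner product of $\mathcal{H}$, $uv^\top$ the rank-one operator $w\mapsto u\,(v^\top w)$, and $\bm{M}^\top$ the adjoint. The model output is $h(\mathbf{x})=(\bm{\beta}_1^\top\phi(\mathbf{x}),\ldots,\bm{\beta}_C^\top\phi(\mathbf{x}))\in\mathbb{R}^C$. It is assumed that $\mathbb{E}\|\phi(\mathbf{x})\|_{\mathcal{H}}^2<\infty$, so that $\Sigma$ is well defined. A feature is a map $f:\mathcal{X}\to\mathcal{H}$. The $\ell_2$-robustness of a feature $f$ with respect to the $c$-th class component is $$s_{\mathcal{D},\bm{\beta},c}(f)=\mathbb{E}_{(\mathbf{x},y)\sim\mathcal{D}}\left[\inf_{\tilde{\mathbf{x}}\in\mathcal{X},\,\|\tilde{\mathbf{x}}-\mathbf{x}\|_2\le\Delta}y_c\,\bm{\beta}_c^\top f(\tilde{\mathbf{x}})\right].$$ $\|\bm{M}\|_{op}$ is the operator norm. *)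

theory Defs
  imports "HOL-Probability.Probability"
begin

definition gam_output :: "('h::real_inner) ^ 'c \<Rightarrow> (real ^ 'd \<Rightarrow> 'h) \<Rightarrow> real ^ 'd \<Rightarrow> real ^ 'c"
  where "gam_output \<beta> \<phi> x = (\<chi> c. (\<beta> $ c) \<bullet> \<phi> x)"

lift_definition rank_one :: "'h::real_inner \<Rightarrow> 'h \<Rightarrow> 'h \<Rightarrow>\<^sub>L 'h"
  is "\<lambda>u v w. (v \<bullet> w) *\<^sub>R u"
  by (rule bounded_linear_compose[OF bounded_linear_scaleR_left bounded_linear_inner_right])

text \<open>
  The expectation of an operator-valued random variable, in the weak sense. The Bochner integral of
  the library needs a second countable codomain, which neither an arbitrary Hilbert space nor its
  space of bounded operators is. Such an operator is always unique; if the expectation of the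
  operator norm of \<open>T\<close> is finite (and the integrands are measurable), it exists by the Riesz
  representation theorem.
\<close>

definition op_expectation :: "'w measure \<Rightarrow> ('w \<Rightarrow> 'h::real_inner \<Rightarrow>\<^sub>L 'h) \<Rightarrow> 'h \<Rightarrow>\<^sub>L 'h"
  where "op_expectation P T =
    (THE S. \<forall>u v. u \<bullet> blinfun_apply S v = (\<integral>\<omega>. u \<bullet> blinfun_apply (T \<omega>) v \<partial>P))"

definition second_moment ::
    "((real ^ 'd) \<times> (real ^ 'c)) measure \<Rightarrow> (real ^ 'd \<Rightarrow> 'h::real_inner) \<Rightarrow> 'h \<Rightarrow>\<^sub>L 'h"
  where "second_moment D \<phi> = op_expectation D (\<lambda>(x, y). rank_one (\<phi> x) (\<phi> x))"

definition worst_case_margin ::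
    "(real ^ 'd) set \<Rightarrow> real \<Rightarrow> ('h::real_inner) ^ 'c \<Rightarrow> 'c \<Rightarrow> (real ^ 'd \<Rightarrow> 'h) \<Rightarrow>
     real ^ 'd \<Rightarrow> real ^ 'c \<Rightarrow> real"
  where "worst_case_margin X \<Delta> \<beta> c f x y =
    (INF x'\<in>{x'\<in>X. norm (x' - x) \<le> \<Delta>}. (y $ c) * ((\<beta> $ c) \<bullet> f x'))"

definition l2_robustness ::
    "(real ^ 'd) set \<Rightarrow> real \<Rightarrow> ((real ^ 'd) \<times> (real ^ 'c)) measure \<Rightarrow> ('h::real_inner) ^ 'c \<Rightarrow> 'c \<Rightarrow>
     (real ^ 'd \<Rightarrow> 'h) \<Rightarrow> real"
  where "l2_robustness X \<Delta> D \<beta> c f = (\<integral>(x, y). worst_case_margin X \<Delta> \<beta> c f x y \<partial>D)"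

text \<open>
  A probability distribution on \<open>X \<times> \<real>\<^sup>C\<close>. Its \<open>\<sigma>\<close>-algebra contains the Borel sets (of the
  subspace topology) but may be larger, so that completed distributions are included. This matters
  because the worst-case margin need not be Borel measurable for an arbitrary \<open>X\<close>.
\<close>

definition distribution_on :: "(real ^ 'd) set \<Rightarrow> ((real ^ 'd) \<times> (real ^ 'c)) measure \<Rightarrow> bool"
  where "distribution_on X D \<longleftrightarrow>
    prob_space D \<and> space D = X \<times> UNIV \<and>
    fst \<in> D \<rightarrow>\<^sub>M restrict_space borel X \<and> snd \<in> D \<rightarrow>\<^sub>M borel"

text \<open>
  The predicate \<open>indep_var\<close> of the library requires both variables to have the same codomain type;
  this is its characterization \<open>indep_var_eq\<close> without that restriction.
\<close>

definition independent_rvs ::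
    "'w measure \<Rightarrow> 'a measure \<Rightarrow> ('w \<Rightarrow> 'a) \<Rightarrow> 'b measure \<Rightarrow> ('w \<Rightarrow> 'b) \<Rightarrow> bool"
  where "independent_rvs P S A T B \<longleftrightarrow>
    A \<in> P \<rightarrow>\<^sub>M S \<and> B \<in> P \<rightarrow>\<^sub>M T \<and>
    prob_space.indep_set P
      (sigma_sets (space P) {A -` E \<inter> space P | E. E \<in> sets S})
      (sigma_sets (space P) {B -` E \<inter> space P | E. E \<in> sets T})"

end

theory Submission
  imports Defs
begin

text \<open>
  The map \<open>x \<mapsto> \<beta>\<^sub>c \<bullet> f x = (M \<beta>\<^sub>c) \<bullet> \<phi> x\<close> is Lipschitz, so the worst-case margin is at least
  \<open>y\<^sub>c ((M \<beta>\<^sub>c) \<bullet> \<phi> x) - \<bar>y\<^sub>c\<bar> L \<Delta> \<parallel>M\<parallel> \<parallel>\<beta>\<^sub>c\<parallel>\<close>. As the noise is centred and independent of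
  \<open>x\<close>, the first term has mean \<open>\<beta>\<^sub>c \<bullet> \<Sigma> M \<beta>\<^sub>c\<close>, and \<open>E \<bar>y\<^sub>c\<bar> \<le> (E y\<^sub>c\<^sup>2)\<^sup>1\<^sup>/\<^sup>2\<close> with
  \<open>E y\<^sub>c\<^sup>2 \<le> \<sigma>\<^sup>2 + \<beta>\<^sub>c \<bullet> \<Sigma> \<beta>\<^sub>c\<close>. The Riesz representation theorem ensures that the choice
  operators defining \<open>adjoint\<close> and \<open>op_expectation\<close> do pick the intended operators.
\<close>

section \<open>Riesz representation and adjoints\<close>

lemma riesz_representation:
  fixes l :: "'h::{real_inner, banach} \<Rightarrow> real"
  assumes "bounded_linear l"
  obtains v where "\<And>x. l x = v \<bullet> x"
proof -
  interpret l: bounded_linear l by fact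
  obtain K where K: "\<And>x. \<bar>l x\<bar> \<le> norm x * K" using l.bounded by auto
  \<comment> \<open>If \<open>l = (\<bullet>) v\<close> then \<open>J x = \<parallel>x - v\<parallel>\<^sup>2 - \<parallel>v\<parallel>\<^sup>2\<close>, so \<open>v\<close> is found as the minimizer of \<open>J\<close>;
    by the parallelogram law minimizing sequences are Cauchy.\<close>
  define J where "J x = x \<bullet> x - 2 * l x" for x
  \<comment> \<open>Completing the square: \<open>J x\<close> is at least
    \<open>(norm x - K)\<^sup>2 - K\<^sup>2\<close>.\<close>
  have low: "- (K\<^sup>2) \<le> J x" for x
  proof -
    have "0 \<le> (norm x - K)\<^sup>2" by simp
    with K[of x] show ?thesis
      by (simp add: J_def power2_norm_eq_inner[symmetric] power2_eq_square algebra_simps)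
  qed
  have bdd: "bdd_below (range J)" using low by (rule bdd_belowI2)
  define m where "m = Inf (range J)"
  have mle: "m \<le> J x" for x unfolding m_def by (rule cInf_lower[OF _ bdd]) simp
  have "\<exists>x. J x < m + inverse (real (Suc n))" for n
    using cInf_lessD[of "range J" "m + inverse (real (Suc n))"] by (auto simp: m_def)
  then obtain X where X: "\<And>n. J (X n) < m + inverse (real (Suc n))" by metis
  have par: "(norm (x - y))\<^sup>2 = 2 * (J x + J y - 2 * J ((1/2) *\<^sub>R (x + y)))" for x y
    unfolding power2_norm_eq_inner J_def l.scaleR l.add
    by (simp add: inner_simps inner_commute algebra_simps)
  \<comment> \<open>The midpoint value of \<open>J\<close> is at least \<open>m\<close>, so two
    near-minimizers are close to each other.\<close>
  have par_le: "(norm (x - y))\<^sup>2 \<le> 2 * (J x + J y - 2 * m)" for x y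
    unfolding par using mle by simp
  have "Cauchy X"
  proof (rule metric_CauchyI)
    fix e :: real assume "0 < e"
    \<comment> \<open>Two excesses over \<open>m\<close> below \<open>e\<^sup>2 / 4\<close>, doubled
      in \<open>par_le\<close>, add up to less than \<open>e\<^sup>2\<close>.\<close>
    then obtain N where N: "inverse (real (Suc N)) < e\<^sup>2 / 4"
      using reals_Archimedean[of "e\<^sup>2 / 4"] by auto
    have J: "J (X n) < m + e\<^sup>2 / 4" if "n \<ge> N" for n
    proof -
      have "inverse (real (Suc n)) \<le> inverse (real (Suc N))" using that by simp
      with X[of n] N show ?thesis by linarith
    qed
    have "dist (X i) (X j) < e" if "i \<ge> N" "j \<ge> N" for i j
    proof -
      have "(norm (X i - X j))\<^sup>2 < e\<^sup>2"
        using add_strict_mono[OF J[OF that(1)] J[OF that(2)]] par_le[of "X i" "X j"]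
        by (simp add: algebra_simps)
      with \<open>0 < e\<close> show ?thesis by (simp add: dist_norm power_less_imp_less_base)
    qed
    then show "\<exists>N. \<forall>i\<ge>N. \<forall>j\<ge>N. dist (X i) (X j) < e" by blast
  qed
  then obtain v where v: "X \<longlonglongrightarrow> v" using Cauchy_convergent convergent_def by blast
  have "(\<lambda>n. J (X n)) \<longlonglongrightarrow> J v" unfolding J_def by (intro tendsto_intros l.tendsto v)
  moreover have "(\<lambda>n. m + inverse (real (Suc n))) \<longlonglongrightarrow> m + 0"
    by (intro tendsto_intros LIMSEQ_inverse_real_of_nat)
  ultimately have "J v \<le> m + 0"
    by (rule LIMSEQ_le) (use less_imp_le[OF X] in blast)
  then have min: "J v \<le> J x" for x using mle[of x] by simp
  have "l x = v \<bullet> x" for x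
  proof (cases "x = 0")
    case False
    define a where "a = v \<bullet> x - l x"
    \<comment> \<open>This \<open>t\<close> minimizes the quadratic
      \<open>2 * t * a + t\<^sup>2 * (x \<bullet> x)\<close>, the change of \<open>J\<close> along
      the line through \<open>v\<close> in direction \<open>x\<close>. Its minimum is negative
      unless \<open>a = 0\<close>.\<close>
    define t where "t = - a / (x \<bullet> x)"
    have "0 \<le> J (v + t *\<^sub>R x) - J v" using min by simp
    also have "\<dots> = 2 * t * a + t * (t * (x \<bullet> x))"
      by (simp add: J_def a_def l.add l.scaleR inner_simps inner_commute algebra_simps)
    also have "\<dots> = - (a\<^sup>2 / (x \<bullet> x))"
      using False by (simp add: t_def power2_eq_square field_simps)
    finally have "a\<^sup>2 / (x \<bullet> x) \<le> 0" by simp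
    moreover have "0 < x \<bullet> x" using False by simp
    ultimately have "a = 0" by (simp only: divide_le_0_iff) auto
    then show ?thesis by (simp add: a_def)
  qed (simp add: l.zero)
  then show thesis by (rule that)
qed

text \<open>\<open>adjoint\<close> is defined by choice, so its characteristic equation needs a
  witness: for each \<open>y\<close>, Riesz represents the functional that sends \<open>x\<close> to
  \<open>T x \<bullet> y\<close>.\<close>

lemma inner_adjoint:
  fixes T :: "'h::{real_inner, banach} \<Rightarrow> 'k::real_inner"
  assumes "bounded_linear T"
  shows "x \<bullet> adjoint T y = T x \<bullet> y"
proof -
  have "\<exists>w. \<forall>x. T x \<bullet> y = x \<bullet> w" for y
    using riesz_representation[OF bounded_linear_compose[OF bounded_linear_inner_left assms], of y]
    by (metis inner_commute)
  then have "\<exists>g. \<forall>x y. T x \<bullet> y = x \<bullet> g y" by metis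
  then show ?thesis unfolding adjoint_def by (rule someI2_ex) simp
qed

section \<open>Weak operator expectations and the second moment\<close>

lemma inner_blinfun_eqI:
  fixes S T :: "'h::real_inner \<Rightarrow>\<^sub>L 'h"
  assumes "\<And>u v. u \<bullet> blinfun_apply S v = u \<bullet> blinfun_apply T v"
  shows "S = T"
proof (rule blinfun_eqI)
  fix v
  have "(S v - T v) \<bullet> (S v - T v) = 0" using assms by (simp add: inner_diff_right)
  then show "S v = T v" by simp
qed

text \<open>Riesz in the first argument gives a vector \<open>g v\<close> for each \<open>v\<close>.
  Uniqueness of representing vectors makes \<open>g\<close> linear, and testing with
  \<open>u = g v\<close> bounds it.\<close>

lemma bounded_bilinear_form_representation:
  fixes B :: "'h::{real_inner, banach} \<Rightarrow> 'h \<Rightarrow> real"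
  assumes "bounded_bilinear B"
  obtains S :: "'h \<Rightarrow>\<^sub>L 'h" where "\<And>u v. u \<bullet> blinfun_apply S v = B u v"
proof -
  interpret B: bounded_bilinear B by fact
  obtain K where "0 \<le> K" and K: "\<And>u v. \<bar>B u v\<bar> \<le> norm u * norm v * K"
    using B.nonneg_bounded by auto
  have "\<exists>w. \<forall>u. B u v = w \<bullet> u" for v
    using riesz_representation[OF B.bounded_linear_left] by metis
  then obtain g where g: "\<And>u v. B u v = g v \<bullet> u" by metis
  have eqI: "x = y" if "\<And>u. x \<bullet> u = y \<bullet> u" for x y :: 'h
  proof -
    have "(x - y) \<bullet> (x - y) = 0" using that by (simp add: inner_diff_left)
    then show ?thesis by simp
  qed
  have "bounded_linear g"
  proof (rule bounded_linear_intro[where K = K])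
    show "g (x + y) = g x + g y" for x y
      by (rule eqI) (simp add: inner_add_left B.add_right flip: g)
    show "g (r *\<^sub>R x) = r *\<^sub>R g x" for r x
      by (rule eqI) (simp add: B.scaleR_right flip: g)
    show "norm (g v) \<le> norm v * K" for v
    proof (cases "g v = 0")
      case True
      with \<open>0 \<le> K\<close> show ?thesis by simp
    next
      case False
      have "norm (g v) * norm (g v) \<le> norm (g v) * (norm v * K)"
        using K[of "g v" v] by (simp add: g dot_square_norm power2_eq_square mult.assoc)
      with False show ?thesis by simp
    qed
  qed
  then have "u \<bullet> blinfun_apply (Blinfun g) v = B u v" for u v
    by (simp add: bounded_linear_Blinfun_apply g inner_commute)
  then show thesis by (rule that)
qed

text \<open>A bounded form provides the existence, and \<open>inner_blinfun_eqI\<close> the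
  uniqueness, that the definite description relies on.\<close>

lemma inner_op_expectation:
  fixes T :: "'w \<Rightarrow> 'h::{real_inner, banach} \<Rightarrow>\<^sub>L 'h"
  assumes "bounded_bilinear (\<lambda>u v. \<integral>\<omega>. u \<bullet> blinfun_apply (T \<omega>) v \<partial>P)"
  shows "u \<bullet> blinfun_apply (op_expectation P T) v = (\<integral>\<omega>. u \<bullet> blinfun_apply (T \<omega>) v \<partial>P)"
proof -
  obtain S :: "'h \<Rightarrow>\<^sub>L 'h"
    where S: "\<And>u v. u \<bullet> blinfun_apply S v = (\<integral>\<omega>. u \<bullet> blinfun_apply (T \<omega>) v \<partial>P)"
    using bounded_bilinear_form_representation[OF assms] by blast
  have "op_expectation P T = S"
    unfolding op_expectation_def
    by (rule the_equality) (use S in \<open>auto intro!: inner_blinfun_eqI\<close>)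
  with S show ?thesis by simp
qed

lemma abs_inner_mult_inner_le:
  fixes u v x :: "'h::real_inner"
  shows "\<bar>(u \<bullet> x) * (v \<bullet> x)\<bar> \<le> norm u * norm v * (norm x)\<^sup>2"
proof -
  have "\<bar>u \<bullet> x\<bar> * \<bar>v \<bullet> x\<bar> \<le> (norm u * norm x) * (norm v * norm x)"
    by (intro mult_mono Cauchy_Schwarz_ineq2) auto
  then show ?thesis by (simp add: abs_mult power2_eq_square mult_ac)
qed

lemma integrable_inner_mult_inner:
  fixes f :: "'w \<Rightarrow> 'h::real_inner"
  assumes "\<And>u. (\<lambda>\<omega>. u \<bullet> f \<omega>) \<in> borel_measurable P" and "integrable P (\<lambda>\<omega>. (norm (f \<omega>))\<^sup>2)"
  shows "integrable P (\<lambda>\<omega>. (u \<bullet> f \<omega>) * (v \<bullet> f \<omega>))"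
proof (rule Bochner_Integration.integrable_bound)
  show "integrable P (\<lambda>\<omega>. norm u * norm v * (norm (f \<omega>))\<^sup>2)" using assms(2) by simp
  show "(\<lambda>\<omega>. (u \<bullet> f \<omega>) * (v \<bullet> f \<omega>)) \<in> borel_measurable P" using assms(1) by measurable
  show "AE \<omega> in P. norm ((u \<bullet> f \<omega>) * (v \<bullet> f \<omega>)) \<le> norm (norm u * norm v * (norm (f \<omega>))\<^sup>2)"
    using abs_inner_mult_inner_le by auto
qed

text \<open>By Cauchy-Schwarz the form on the right is bounded, with the second moment of
  \<open>norm (\<phi> x)\<close> as constant, so the weak expectation of the rank-one operators
  exists.\<close>

lemma inner_second_moment:
  fixes \<phi> :: "real ^ 'd \<Rightarrow> 'h::{real_inner, banach}"
    and D :: "((real ^ 'd) \<times> (real ^ 'c)) measure"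
  assumes meas: "\<And>u. (\<lambda>\<omega>. u \<bullet> \<phi> (fst \<omega>)) \<in> borel_measurable D"
    and int: "integrable D (\<lambda>\<omega>. (norm (\<phi> (fst \<omega>)))\<^sup>2)"
  shows "u \<bullet> blinfun_apply (second_moment D \<phi>) v = (\<integral>\<omega>. (u \<bullet> \<phi> (fst \<omega>)) * (v \<bullet> \<phi> (fst \<omega>)) \<partial>D)"
proof -
  note I = integrable_inner_mult_inner[OF meas int]
  let ?B = "\<lambda>u v. \<integral>\<omega>. (u \<bullet> \<phi> (fst \<omega>)) * (v \<bullet> \<phi> (fst \<omega>)) \<partial>D"
  have form: "u \<bullet> blinfun_apply (case \<omega> of (x, y) \<Rightarrow> rank_one (\<phi> x) (\<phi> x)) v
      = (u \<bullet> \<phi> (fst \<omega>)) * (v \<bullet> \<phi> (fst \<omega>))" for u v and \<omega> :: "(real ^ 'd) \<times> (real ^ 'c)"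
    by (cases \<omega>) (simp add: rank_one.rep_eq inner_commute mult.commute)
  have bound: "\<bar>?B u v\<bar> \<le> norm u * norm v * (\<integral>\<omega>. (norm (\<phi> (fst \<omega>)))\<^sup>2 \<partial>D)" for u v
  proof -
    have "\<bar>?B u v\<bar> \<le> (\<integral>\<omega>. \<bar>(u \<bullet> \<phi> (fst \<omega>)) * (v \<bullet> \<phi> (fst \<omega>))\<bar> \<partial>D)"
      by (rule integral_abs_bound)
    also have "\<dots> \<le> (\<integral>\<omega>. norm u * norm v * (norm (\<phi> (fst \<omega>)))\<^sup>2 \<partial>D)"
      by (intro integral_mono abs_inner_mult_inner_le) (use I int in simp_all)
    finally show ?thesis by simp
  qed
  have "bounded_bilinear ?B"
  proof
    show "\<exists>K. \<forall>u v. norm (?B u v) \<le> norm u * norm v * K" using bound by auto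
  qed (simp_all add: I inner_add_left distrib_left distrib_right mult.left_commute mult.assoc)
  then show ?thesis
    unfolding second_moment_def by (subst inner_op_expectation) (simp_all add: form)
qed

section \<open>Moments and independence\<close>

text \<open>The inequality is nonnegativity of the variance of \<open>\<bar>X\<bar>\<close>.\<close>

lemma (in prob_space) expectation_abs_le_sqrt:
  fixes X :: "'a \<Rightarrow> real"
  assumes "random_variable borel X" and "integrable M (\<lambda>\<omega>. (X \<omega>)\<^sup>2)"
  shows "integrable M X" and "expectation (\<lambda>\<omega>. \<bar>X \<omega>\<bar>) \<le> sqrt (expectation (\<lambda>\<omega>. (X \<omega>)\<^sup>2))"
proof -
  show int: "integrable M X" using assms by (rule square_integrable_imp_integrable)
  have "0 \<le> variance (\<lambda>\<omega>. \<bar>X \<omega>\<bar>)" by (rule variance_positive)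
  also have "\<dots> = expectation (\<lambda>\<omega>. (X \<omega>)\<^sup>2) - (expectation (\<lambda>\<omega>. \<bar>X \<omega>\<bar>))\<^sup>2"
    using int assms(2) by (subst variance_eq) auto
  finally show "expectation (\<lambda>\<omega>. \<bar>X \<omega>\<bar>) \<le> sqrt (expectation (\<lambda>\<omega>. (X \<omega>)\<^sup>2))"
    by (intro real_le_rsqrt) simp
qed

text \<open>A function of \<open>A\<close> generates a sub-\<sigma>-algebra of the one generated by
  \<open>A\<close>, and likewise for \<open>B\<close>. Since \<open>f\<close> and \<open>g\<close>
  map into a common type, \<open>indep_var\<close> and its product rule for expectations become
  available.\<close>

lemma (in prob_space) indep_var_if_independent_rvs:
  assumes "independent_rvs M S A T B" and f: "f \<in> S \<rightarrow>\<^sub>M S'" and g: "g \<in> T \<rightarrow>\<^sub>M T'"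
  shows "indep_var S' (\<lambda>\<omega>. f (A \<omega>)) T' (\<lambda>\<omega>. g (B \<omega>))"
proof -
  have A: "A \<in> M \<rightarrow>\<^sub>M S" and B: "B \<in> M \<rightarrow>\<^sub>M T"
    and ind: "indep_set (sigma_sets (space M) {A -` E \<inter> space M | E. E \<in> sets S})
      (sigma_sets (space M) {B -` E \<inter> space M | E. E \<in> sets T})"
    using assms(1) by (auto simp: independent_rvs_def)
  have sub: "sigma_sets (space M) {(\<lambda>\<omega>. h (Z \<omega>)) -` E \<inter> space M | E. E \<in> sets N'}
      \<subseteq> sigma_sets (space M) {Z -` E \<inter> space M | E. E \<in> sets N}"
    if Z: "Z \<in> M \<rightarrow>\<^sub>M N" and h: "h \<in> N \<rightarrow>\<^sub>M N'" for h Z and N :: "'x measure" and N' :: "'y measure"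
  proof (rule sigma_sets_mono', safe)
    fix E assume "E \<in> sets N'"
    then have "h -` E \<inter> space N \<in> sets N" using h by (rule measurable_sets[rotated])
    moreover have "(\<lambda>\<omega>. h (Z \<omega>)) -` E \<inter> space M = Z -` (h -` E \<inter> space N) \<inter> space M"
      using measurable_space[OF Z] by auto
    ultimately show "\<exists>F. (\<lambda>\<omega>. h (Z \<omega>)) -` E \<inter> space M = Z -` F \<inter> space M \<and> F \<in> sets N"
      by blast
  qed
  show ?thesis
    unfolding indep_var_eq
  proof (intro conjI measurable_compose[OF A f] measurable_compose[OF B g])
    show "indep_set (sigma_sets (space M) {(\<lambda>\<omega>. f (A \<omega>)) -` E \<inter> space M | E. E \<in> sets S'})
      (sigma_sets (space M) {(\<lambda>\<omega>. g (B \<omega>)) -` E \<inter> space M | E. E \<in> sets T'})"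
      unfolding indep_set_def
      by (rule indep_sets_mono_sets[OF ind[unfolded indep_set_def]])
        (simp add: sub[OF A f] sub[OF B g] split: bool.split)
  qed
qed

section \<open>Pointwise bounds on the margin\<close>

text \<open>The lower bound is Cauchy-Schwarz with the Lipschitz condition, after moving the adjoint
  onto \<open>\<beta> $ c\<close>. The upper bound holds because \<open>x\<close> is itself an
  admissible perturbation; it serves to make the margin integrable.\<close>

lemma worst_case_margin_bounds:
  fixes \<beta> :: "('h::{real_inner, banach}) ^ 'c" and M :: "'h \<Rightarrow>\<^sub>L 'h"
    and x :: "real ^ 'd" and y :: "real ^ 'c" and c :: 'c
  assumes "0 \<le> \<Delta>" and "L-lipschitz_on X \<phi>" and "x \<in> X"
  defines "w \<equiv> worst_case_margin X \<Delta> \<beta> c (\<lambda>x. adjoint (blinfun_apply M) (\<phi> x)) x y"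
    and "g \<equiv> blinfun_apply M (\<beta> $ c) \<bullet> \<phi> x"
  shows "y $ c * g - \<bar>y $ c\<bar> * (L * \<Delta> * norm M * norm (\<beta> $ c)) \<le> w" and "w \<le> y $ c * g"
proof -
  let ?A = "{x'\<in>X. norm (x' - x) \<le> \<Delta>}" and ?b = "blinfun_apply M (\<beta> $ c)"
  let ?r = "L * \<Delta> * norm M * norm (\<beta> $ c)"
  have w: "w = (INF x'\<in>?A. y $ c * (?b \<bullet> \<phi> x'))"
    unfolding w_def worst_case_margin_def
    by (simp add: inner_adjoint[OF blinfun.bounded_linear_right])
  have x: "x \<in> ?A" using assms by simp
  have L: "0 \<le> L" using assms(2) by (rule lipschitz_on_nonneg)
  have le: "y $ c * g - \<bar>y $ c\<bar> * ?r \<le> y $ c * (?b \<bullet> \<phi> x')" if "x' \<in> ?A" for x'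
  proof -
    have "\<bar>?b \<bullet> (\<phi> x - \<phi> x')\<bar> \<le> norm ?b * norm (\<phi> x - \<phi> x')" by (rule Cauchy_Schwarz_ineq2)
    also have "\<dots> \<le> (norm M * norm (\<beta> $ c)) * (L * \<Delta>)"
    proof (intro mult_mono norm_blinfun)
      have "norm (\<phi> x - \<phi> x') \<le> L * norm (x - x')"
        using lipschitz_onD[OF assms(2), of x x'] that assms(3) by (simp add: dist_norm)
      also have "\<dots> \<le> L * \<Delta>" using that L by (intro mult_left_mono) (auto simp: norm_minus_commute)
      finally show "norm (\<phi> x - \<phi> x') \<le> L * \<Delta>" .
    qed auto
    finally have "\<bar>y $ c\<bar> * \<bar>?b \<bullet> (\<phi> x - \<phi> x')\<bar> \<le> \<bar>y $ c\<bar> * ?r"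
      by (intro mult_left_mono) (auto simp: mult_ac)
    moreover have "y $ c * (?b \<bullet> (\<phi> x - \<phi> x')) \<le> \<bar>y $ c\<bar> * \<bar>?b \<bullet> (\<phi> x - \<phi> x')\<bar>"
      by (simp flip: abs_mult)
    ultimately show ?thesis by (simp add: g_def inner_diff_right right_diff_distrib)
  qed
  show "y $ c * g - \<bar>y $ c\<bar> * ?r \<le> w" unfolding w using x le by (intro cINF_greatest) auto
  show "w \<le> y $ c * g" unfolding w g_def
    \<comment> \<open>An infimum of reals is a lower bound only for a set bounded below, which
      \<open>le\<close> guarantees.\<close>
    using x le by (intro cINF_lower bdd_belowI2) auto
qed

section \<open>Integrating the pointwise bound\<close>

theorem theorem3p2:
  fixes X :: "(real ^ 'd) set"
    and D :: "((real ^ 'd) \<times> (real ^ 'c)) measure"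
    and \<phi> :: "real ^ 'd \<Rightarrow> 'h::{real_inner, banach}"
    and \<beta> :: "'h ^ 'c"
    and \<epsilon> :: "(real ^ 'd) \<times> (real ^ 'c) \<Rightarrow> real ^ 'c"
    and \<Delta> L \<sigma> :: real
    and M :: "'h \<Rightarrow>\<^sub>L 'h"
    and c :: 'c
  assumes "\<Delta> \<ge> 0"
    and "distribution_on X D"
    and "integrable D (\<lambda>(x, y). (norm (\<phi> x))\<^sup>2)"
    and "AE (x, y) in D. y = gam_output \<beta> \<phi> x + \<epsilon> (x, y)"
    and "independent_rvs D (restrict_space borel X) fst borel \<epsilon>"
    and "prob_space.indep_vars D (\<lambda>_. borel) (\<lambda>k \<omega>. \<epsilon> \<omega> $ k) UNIV"
    and "\<And>k. integrable D (\<lambda>\<omega>. \<epsilon> \<omega> $ k)"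
    and "\<And>k. (\<integral>\<omega>. \<epsilon> \<omega> $ k \<partial>D) = 0"
    and "\<And>k. integrable D (\<lambda>\<omega>. (\<epsilon> \<omega> $ k)\<^sup>2)"
    and "\<And>k. (\<integral>\<omega>. (\<epsilon> \<omega> $ k)\<^sup>2 \<partial>D) \<le> \<sigma>\<^sup>2"
    and "L-lipschitz_on X \<phi>"
    and "(\<lambda>(x, y). worst_case_margin X \<Delta> \<beta> c (\<lambda>x. adjoint (blinfun_apply M) (\<phi> x)) x y)
           \<in> borel_measurable D"
  shows "l2_robustness X \<Delta> D \<beta> c (\<lambda>x. adjoint (blinfun_apply M) (\<phi> x)) \<ge>
    (\<beta> $ c) \<bullet> blinfun_apply (second_moment D \<phi>) (blinfun_apply M (\<beta> $ c))
      - L * \<Delta> * norm M * norm (\<beta> $ c)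
          * sqrt (\<sigma>\<^sup>2 + (\<beta> $ c) \<bullet> blinfun_apply (second_moment D \<phi>) (\<beta> $ c))"
proof -
  note \<Delta> = assms(1) and noise = assms(4) and eps_int = assms(7) and eps0 = assms(8)
    and eps2_int = assms(9) and eps2 = assms(10) and lip = assms(11)
  interpret prob_space D using assms(2) by (simp add: distribution_on_def)
  have space: "space D = X \<times> UNIV" and fst: "fst \<in> D \<rightarrow>\<^sub>M restrict_space borel X"
    and snd: "snd \<in> D \<rightarrow>\<^sub>M borel"
    using assms(2) by (auto simp: distribution_on_def)
  have phi2: "integrable D (\<lambda>\<omega>. (norm (\<phi> (fst \<omega>)))\<^sup>2)" using assms(3) by (simp add: case_prod_unfold)
  \<comment> \<open>A Lipschitz map is continuous on \<open>X\<close>, hence each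
    \<open>u \<bullet> \<phi> x\<close> is Borel for the subspace topology.\<close>
  have inner_meas: "(\<lambda>x. u \<bullet> \<phi> x) \<in> borel_measurable (restrict_space borel X)" for u
    using lipschitz_on_continuous_on[OF lip]
    by (intro borel_measurable_continuous_on_restrict continuous_intros)
  note meas = measurable_compose[OF fst inner_meas]
  note I = integrable_inner_mult_inner[OF meas phi2]
  note Sigma = inner_second_moment[OF meas phi2]
  define b where "b = \<beta> $ c"
  define a where "a = blinfun_apply M b"
  define e where "e \<omega> = \<epsilon> \<omega> $ c" for \<omega>
  \<comment> \<open>The most by which a perturbation can lower the margin, per unit of
    \<open>\<bar>Y \<omega>\<bar>\<close>.\<close>
  define r where "r = L * \<Delta> * norm M * norm b"
  have r: "0 \<le> r" using \<Delta> lipschitz_on_nonneg[OF lip] by (simp add: r_def)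
  define Y where "Y \<omega> = snd \<omega> $ c" for \<omega> :: "(real ^ 'd) \<times> (real ^ 'c)"
  define W where "W =
    (\<lambda>(x, y). worst_case_margin X \<Delta> \<beta> c (\<lambda>x. adjoint (blinfun_apply M) (\<phi> x)) x y)"
  define S where "S = blinfun_apply (second_moment D \<phi>)"
  have nth_meas: "(\<lambda>y :: real ^ 'c. y $ c) \<in> borel_measurable borel"
    by (intro borel_measurable_continuous_onI continuous_intros)
  have Y_meas [measurable]: "Y \<in> borel_measurable D"
    unfolding Y_def by (rule measurable_compose[OF snd nth_meas])
  have Y: "AE \<omega> in D. Y \<omega> = b \<bullet> \<phi> (fst \<omega>) + e \<omega>"
    using noise
  proof eventually_elim
    case (elim \<omega>)
    then have "snd \<omega> = gam_output \<beta> \<phi> (fst \<omega>) + \<epsilon> \<omega>"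
      by (simp only: case_prod_unfold prod.collapse)
    then have "snd \<omega> $ c = (gam_output \<beta> \<phi> (fst \<omega>) + \<epsilon> \<omega>) $ c" by (rule arg_cong)
    then show ?case by (simp add: Y_def b_def e_def gam_output_def)
  qed
  have lin_int: "integrable D (\<lambda>\<omega>. u \<bullet> \<phi> (fst \<omega>))" for u
    using I[of u u] by (auto intro: square_integrable_imp_integrable[OF meas] simp: power2_eq_square)
  have ind: "indep_var borel (\<lambda>\<omega>. u \<bullet> \<phi> (fst \<omega>)) borel e" for u
    unfolding e_def
    by (rule indep_var_if_independent_rvs[OF assms(5) inner_meas nth_meas])
  have e_int: "integrable D e" and e2_int: "integrable D (\<lambda>\<omega>. (e \<omega>)\<^sup>2)"
    and e0: "expectation e = 0" and e2: "expectation (\<lambda>\<omega>. (e \<omega>)\<^sup>2) \<le> \<sigma>\<^sup>2"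
    using eps_int eps2_int eps0 eps2 unfolding e_def by auto
  \<comment> \<open>For independent factors, integrability of each one gives integrability of the
    product; its mean factorizes and vanishes because \<open>e\<close> is centred.\<close>
  have cross_int: "integrable D (\<lambda>\<omega>. (u \<bullet> \<phi> (fst \<omega>)) * e \<omega>)" for u
    by (rule indep_var_integrable[OF ind lin_int e_int])
  have cross: "expectation (\<lambda>\<omega>. (u \<bullet> \<phi> (fst \<omega>)) * e \<omega>) = 0" for u
    using indep_var_lebesgue_integral[OF ind lin_int e_int] e0 by simp
  have Ya: "AE \<omega> in D. Y \<omega> * (a \<bullet> \<phi> (fst \<omega>))
      = (b \<bullet> \<phi> (fst \<omega>)) * (a \<bullet> \<phi> (fst \<omega>)) + (a \<bullet> \<phi> (fst \<omega>)) * e \<omega>"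
    using Y by eventually_elim (simp add: algebra_simps)
  have Y2: "AE \<omega> in D. (Y \<omega>)\<^sup>2
      = (b \<bullet> \<phi> (fst \<omega>)) * (b \<bullet> \<phi> (fst \<omega>)) + 2 * ((b \<bullet> \<phi> (fst \<omega>)) * e \<omega>) + (e \<omega>)\<^sup>2"
    using Y by eventually_elim (simp add: algebra_simps power2_eq_square)
  have Ya_meas: "(\<lambda>\<omega>. Y \<omega> * (a \<bullet> \<phi> (fst \<omega>))) \<in> borel_measurable D"
    using meas[of a] by measurable
  \<comment> \<open>The model equation holds only almost everywhere, so integrability and
    expectations of \<open>Y\<close> terms are carried over from the expanded right-hand
    sides.\<close>
  have Ya_int: "integrable D (\<lambda>\<omega>. Y \<omega> * (a \<bullet> \<phi> (fst \<omega>)))"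
    by (rule integrable_cong_AE_imp[OF Bochner_Integration.integrable_add[OF I cross_int] Ya_meas
        AE_symmetric[OF Ya]])
  have "expectation (\<lambda>\<omega>. Y \<omega> * (a \<bullet> \<phi> (fst \<omega>)))
      = expectation (\<lambda>\<omega>. (b \<bullet> \<phi> (fst \<omega>)) * (a \<bullet> \<phi> (fst \<omega>)) + (a \<bullet> \<phi> (fst \<omega>)) * e \<omega>)"
    by (rule integral_cong_AE[OF Ya_meas _ Ya]) (use I cross_int in simp)
  also have "\<dots> = b \<bullet> S a"
    by (simp add: I cross_int cross Sigma S_def)
  finally have EYa: "expectation (\<lambda>\<omega>. Y \<omega> * (a \<bullet> \<phi> (fst \<omega>))) = b \<bullet> S a" .
  have sum_int: "integrable D (\<lambda>\<omega>.
      (b \<bullet> \<phi> (fst \<omega>)) * (b \<bullet> \<phi> (fst \<omega>)) + 2 * ((b \<bullet> \<phi> (fst \<omega>)) * e \<omega>) + (e \<omega>)\<^sup>2)"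
    using I cross_int e2_int by simp
  have Y2_int: "integrable D (\<lambda>\<omega>. (Y \<omega>)\<^sup>2)"
    by (rule integrable_cong_AE_imp[OF sum_int _ AE_symmetric[OF Y2]]) simp
  have "expectation (\<lambda>\<omega>. (Y \<omega>)\<^sup>2) = expectation (\<lambda>\<omega>.
      (b \<bullet> \<phi> (fst \<omega>)) * (b \<bullet> \<phi> (fst \<omega>)) + 2 * ((b \<bullet> \<phi> (fst \<omega>)) * e \<omega>) + (e \<omega>)\<^sup>2)"
    by (rule integral_cong_AE[OF _ _ Y2]) (use sum_int in simp_all)
  \<comment> \<open>The signal part has mean \<open>b \<bullet> S b\<close>, the cross term has mean
    zero, and the noise part has mean at most \<open>\<sigma>\<^sup>2\<close>.\<close>
  also have "\<dots> \<le> \<sigma>\<^sup>2 + b \<bullet> S b"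
    using e2 by (simp add: I cross_int cross e2_int Sigma S_def)
  finally have EY2: "expectation (\<lambda>\<omega>. (Y \<omega>)\<^sup>2) \<le> \<sigma>\<^sup>2 + b \<bullet> S b" .
  note Y_int = expectation_abs_le_sqrt(1)[OF Y_meas Y2_int]
  have EY: "expectation (\<lambda>\<omega>. \<bar>Y \<omega>\<bar>) \<le> sqrt (\<sigma>\<^sup>2 + b \<bullet> S b)"
    using expectation_abs_le_sqrt(2)[OF Y_meas Y2_int] EY2 by (meson order_trans real_sqrt_le_mono)
  have W: "Y \<omega> * (a \<bullet> \<phi> (fst \<omega>)) - \<bar>Y \<omega>\<bar> * r \<le> W \<omega>" "W \<omega> \<le> Y \<omega> * (a \<bullet> \<phi> (fst \<omega>))"
    if "\<omega> \<in> space D" for \<omega>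
    using worst_case_margin_bounds[OF \<Delta> lip, where x = "fst \<omega>" and y = "snd \<omega>"
        and c = c and \<beta> = \<beta> and M = M] that
    by (auto simp: space W_def Y_def a_def b_def r_def split_beta)
  have low_int: "integrable D (\<lambda>\<omega>. Y \<omega> * (a \<bullet> \<phi> (fst \<omega>)) - \<bar>Y \<omega>\<bar> * r)"
    using Ya_int Y_int by simp
  \<comment> \<open>A non-integrable \<open>W\<close> would have integral 0 by convention, so
    monotonicity needs this first. The two bounds in \<open>W\<close> enclose the margin between
    integrable functions.\<close>
  have W_int: "integrable D W"
  proof (rule Bochner_Integration.integrable_bound)
    show "integrable D (\<lambda>\<omega>. \<bar>Y \<omega> * (a \<bullet> \<phi> (fst \<omega>))\<bar> + \<bar>Y \<omega>\<bar> * r)"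
      using Ya_int Y_int by simp
    show "W \<in> borel_measurable D" unfolding W_def by (rule assms(12))
    show "AE \<omega> in D. norm (W \<omega>) \<le> norm (\<bar>Y \<omega> * (a \<bullet> \<phi> (fst \<omega>))\<bar> + \<bar>Y \<omega>\<bar> * r)"
    proof (rule AE_I2)
      fix \<omega> assume "\<omega> \<in> space D"
      note W[OF this]
      moreover have "0 \<le> \<bar>Y \<omega>\<bar> * r" using r by simp
      ultimately show "norm (W \<omega>) \<le> norm (\<bar>Y \<omega> * (a \<bullet> \<phi> (fst \<omega>))\<bar> + \<bar>Y \<omega>\<bar> * r)"
        unfolding real_norm_def by linarith
    qed
  qed
  \<comment> \<open>Nonnegativity of \<open>r\<close> lets the upper bound on the mean of
    \<open>\<bar>Y \<omega>\<bar>\<close> be used under the minus sign.\<close>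
  have "b \<bullet> S a - r * sqrt (\<sigma>\<^sup>2 + b \<bullet> S b) \<le> b \<bullet> S a - expectation (\<lambda>\<omega>. \<bar>Y \<omega>\<bar>) * r"
    using mult_left_mono[OF EY r] by (simp add: mult.commute)
  also have "\<dots> = expectation (\<lambda>\<omega>. Y \<omega> * (a \<bullet> \<phi> (fst \<omega>)) - \<bar>Y \<omega>\<bar> * r)"
    using Ya_int Y_int by (simp add: EYa)
  also have "\<dots> \<le> expectation W"
    by (rule integral_mono[OF low_int W_int]) (rule W(1))
  finally show ?thesis
    by (simp add: l2_robustness_def W_def S_def a_def b_def r_def)
qed

end
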